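(* Let $r>d/2$ and consider the nonlinear Schrödinger equation $$i\partial_t u=-\Delta u+F(u,\bar u)\quad\text{on }(0,T)\times\mathbb{T}^d,\qquad u(0)=u_0 .$$ Let $\mathcal F_\tau$ be the exact fine propagator and let $\mathcal G_\tau(v)=e^{i\tau\Delta}v+\Phi_c(\tau;v)$ be a coarse propagator of exponential type. Assume that, for $R>0$ and $B_R=\{v\in H^r(\mathbb T^d):\|v\|_{H^r}\le R\}$, the following inequalities hold for all $w_0,v_0\in B_R$ and $0<\tau\le 1$, with a constant $C_R$ independent of $w_0$, $v_0$ and $\tau$: (i) $\|\Phi_c(\tau;w_0)-\Phi_c(\tau;v_0)\|_{H^r}\le C_R\,\tau\,\|w_0-v_0\|_{H^r}$, (ii) $\|(\mathcal F_\tau-\mathcal G_\tau)(w_0)-(\mathcal F_\tau-\mathcal G_\tau)(v_0)\|_{H^r}\le C_R\,\tau^2\,\|w_0-v_0\|_{H^r}$. Assume also that the equation admits an exact solution $u\in C([0,T];H^r(\mathbb{T}^d))$. Let $U_n^k$ denote the parareal approximation obtained with the coarse propagator $\mathcal G_\tau$ and the fine propagator $\mathcal F_\tau$ at the $k$-th iteration and the $n$-th coarse grid point $T_n=n\tau$, and let $U_n=u(T_n)$. Then there exist constants $\tau_0$, $C_1$ and $C_2$, independent of $n$ and $k$, such that, for any $0<\tau\le\tau_0$, $$\max_{1\le n\le N_c}\|U_n^k-U_n\|_{H^r}\le C_1(C_2\tau)^k .$$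
   Context: $\mathbb{T}^d=(0,2\pi)^d$ with periodic boundary conditions; $F(u,\bar u)$ is the given nonlinearity; $\tau$ is the coarse time-step size and $N_c=T/\tau\in\mathbb N$ is the number of coarse intervals. Exact fine propagator: $\mathcal F_\tau(v)=v(\tau)=e^{i\tau\Delta}v-i\int_0^\tau e^{i(\tau-s)\Delta}F(v(s),\overline{v}(s))\,ds$, where $v(s)$ is the exact solution of the equation at time $s$ with initial value $v$ at time $0$. Coarse propagator: $\Phi_c(\tau;\cdot)$ is the part of the one-step method that propagates the nonhomogeneous (nonlinear) term. Parareal algorithm: $U_0^k=u_0$ for all $k$, and $$U_{n+1}^0=\mathcal G_\tau(U_n^0),\qquad U_{n+1}^{k+1}=\mathcal G_\tau(U_n^{k+1})+(\mathcal F_\tau-\mathcal G_\tau)(U_n^k),$$ for $n=0,\dots,N_c-1$ and $k=0,1,2,\dots$.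
   Formalization: The formal theorem additionally assumes the coarse propagator is consistent at zero, ‖(F_τ−G_τ)(0)‖_{H^r}=o(τ) as τ→0; without it the claim fails at k=0 (F=0, Φ_c a nonzero constant function). *)

theory Defs
  imports "HOL-Analysis.Analysis" "HOL-Library.Function_Algebras"
begin

text \<open>
  Functions on the torus are $2\pi$-periodic functions on \<open>real^'n\<close>, with \<open>d = CARD('n)\<close>.
  Sums and differences of functions are the pointwise ones of \<open>HOL-Library.Function_Algebras\<close>.
\<close>

type_synonym 'n torus_fun = "real^'n \<Rightarrow> complex"

definition periodic :: "'n::finite torus_fun \<Rightarrow> bool" where
  "periodic v \<longleftrightarrow> (\<forall>x j. v (x + axis j (2 * pi)) = v x)"

definition freq_inner :: "int^'n::finite \<Rightarrow> real^'n \<Rightarrow> real" where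
  "freq_inner k x = (\<Sum>j\<in>UNIV. real_of_int (k $ j) * x $ j)"

definition freq_sq :: "int^'n::finite \<Rightarrow> real" where
  "freq_sq k = (\<Sum>j\<in>UNIV. (real_of_int (k $ j))\<^sup>2)"

definition fourier_coeff :: "'n::finite torus_fun \<Rightarrow> int^'n \<Rightarrow> complex" where
  "fourier_coeff v k =
     integral (box 0 (\<chi> j. 2 * pi)) (\<lambda>x. v x * cis (- freq_inner k x)) /
     of_real ((2 * pi) ^ CARD('n))"

text \<open>
  The Sobolev space $H^r$ of the torus. For \<open>r > d/2\<close>, the only range in which it is used here,
  every class in $H^r$ has exactly one continuous representative, and \<open>sobolev r\<close> consists of
  these representatives; so equality in $H^r$ is equality of functions. For \<open>r \<le> d/2\<close> the
  definition would give a proper subspace of $H^r$.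
\<close>

definition sobolev :: "real \<Rightarrow> 'n::finite torus_fun set" where
  "sobolev r = {v. continuous_on UNIV v \<and> periodic v \<and>
     (\<lambda>k. (1 + freq_sq k) powr r * (cmod (fourier_coeff v k))\<^sup>2) summable_on UNIV}"

definition sobolev_norm :: "real \<Rightarrow> 'n::finite torus_fun \<Rightarrow> real" where
  "sobolev_norm r v =
     sqrt (\<Sum>\<^sub>\<infinity>k. (1 + freq_sq k) powr r * (cmod (fourier_coeff v k))\<^sup>2)"

definition sobolev_ball :: "real \<Rightarrow> real \<Rightarrow> 'n::finite torus_fun set" where
  "sobolev_ball r R = {v \<in> sobolev r. sobolev_norm r v \<le> R}"

text \<open>The space $C([0,T];H^r)$; values of the curve outside \<open>{0..T}\<close> are irrelevant.\<close>

definition sobolev_curve :: "real \<Rightarrow> real \<Rightarrow> (real \<Rightarrow> 'n::finite torus_fun) \<Rightarrow> bool" where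
  "sobolev_curve r T u \<longleftrightarrow>
     (\<forall>t\<in>{0..T}. u t \<in> sobolev r \<and>
        ((\<lambda>s. sobolev_norm r (u s - u t)) \<longlongrightarrow> 0) (at t within {0..T}))"

text \<open>The group $e^{it\Delta}$; the Fourier series converges absolutely on \<open>sobolev r\<close>, \<open>r > d/2\<close>.\<close>

definition schroedinger_group :: "real \<Rightarrow> 'n::finite torus_fun \<Rightarrow> 'n torus_fun" where
  "schroedinger_group t v =
     (\<lambda>x. \<Sum>\<^sub>\<infinity>k. cis (- t * freq_sq k) * fourier_coeff v k * cis (freq_inner k x))"

definition nonlinearity :: "(complex \<Rightarrow> complex \<Rightarrow> complex) \<Rightarrow> 'n::finite torus_fun \<Rightarrow> 'n torus_fun" where
  "nonlinearity F v = (\<lambda>x. F (v x) (cnj (v x)))"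

text \<open>
  Exact solutions in $C([0,T];H^r)$ of $i\partial_t u = -\Delta u + F(u,\bar u)$, $u(0) = u_0$,
  in Duhamel form. Since the nonlinear term is a continuous curve in $H^r$, the integrand is
  continuous with values in $H^r$; as point evaluation is continuous on $H^r$ for \<open>r > d/2\<close>, the
  pointwise integral below is its $H^r$-valued integral.
\<close>

definition exact_solution ::
  "real \<Rightarrow> (complex \<Rightarrow> complex \<Rightarrow> complex) \<Rightarrow> real \<Rightarrow> 'n::finite torus_fun \<Rightarrow> (real \<Rightarrow> 'n torus_fun) \<Rightarrow> bool"
  where
  "exact_solution r F T u0 u \<longleftrightarrow>
     sobolev_curve r T u \<and> sobolev_curve r T (\<lambda>s. nonlinearity F (u s)) \<and> u 0 = u0 \<and>
     (\<forall>t\<in>{0..T}. \<forall>x. u t x = schroedinger_group t u0 x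
        - \<i> * integral {0..t} (\<lambda>s. schroedinger_group (t - s) (nonlinearity F (u s)) x))"

text \<open>
  \<open>fine_value r F \<tau> v z\<close>: some exact solution starting at \<open>v\<close> takes the value \<open>z\<close> at time \<open>\<tau>\<close>.
  The fine propagator is meaningful at \<open>\<tau>\<close> and \<open>v\<close> only if there is exactly one such \<open>z\<close>.
\<close>

definition fine_value ::
  "real \<Rightarrow> (complex \<Rightarrow> complex \<Rightarrow> complex) \<Rightarrow> real \<Rightarrow> 'n::finite torus_fun \<Rightarrow> 'n torus_fun \<Rightarrow> bool" where
  "fine_value r F \<tau> v z \<longleftrightarrow> (\<exists>w. exact_solution r F \<tau> v w \<and> z = w \<tau>)"

definition fine_propagator ::
  "real \<Rightarrow> (complex \<Rightarrow> complex \<Rightarrow> complex) \<Rightarrow> real \<Rightarrow> 'n::finite torus_fun \<Rightarrow> 'n torus_fun" where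
  "fine_propagator r F \<tau> v = (THE z. fine_value r F \<tau> v z)"

definition coarse_propagator ::
  "(real \<Rightarrow> 'n::finite torus_fun \<Rightarrow> 'n torus_fun) \<Rightarrow> real \<Rightarrow> 'n torus_fun \<Rightarrow> 'n torus_fun" where
  "coarse_propagator \<Phi> \<tau> v = schroedinger_group \<tau> v + \<Phi> \<tau> v"

text \<open>\<open>parareal \<G> \<F> u0 k n\<close> is $U_n^k$: iteration \<open>k\<close>, coarse grid point \<open>n\<close>.\<close>

fun parareal ::
  "('n::finite torus_fun \<Rightarrow> 'n torus_fun) \<Rightarrow> ('n torus_fun \<Rightarrow> 'n torus_fun) \<Rightarrow> 'n torus_fun \<Rightarrow> nat \<Rightarrow> nat \<Rightarrow> 'n torus_fun" where
  "parareal \<G> \<F> u0 k 0 = u0"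
| "parareal \<G> \<F> u0 0 (Suc n) = \<G> (parareal \<G> \<F> u0 0 n)"
| "parareal \<G> \<F> u0 (Suc k) (Suc n) =
     \<G> (parareal \<G> \<F> u0 (Suc k) n) + (\<F> - \<G>) (parareal \<G> \<F> u0 k n)"

end

theory Submission
  imports Defs
begin

text \<open>
  Since the flow is autonomous, $u(T_{n+1}) = \mathcal F_\tau(u(T_n))$; by uniqueness this only needs
  that a time shift of a Duhamel solution is again one, which is checked on Fourier coefficients. With
  $e^k_n = \|U^k_n - u(T_n)\|_{H^r}$, the isometry of $e^{i\tau\Delta}$ and (i), (ii) give
  $e^{k+1}_{n+1} \le (1 + C\tau)\, e^{k+1}_n + C\tau^2 e^k_n$ as long as the iterates stay in the ball of
  radius $\sup \|u\|_{H^r} + 1$. A discrete Gronwall estimate turns this into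
  $\max_n e^{k+1}_n \le C T e^{CT} \tau \max_n e^k_n$, and for small \<open>\<tau>\<close> the bound itself
  keeps the iterates in the ball. The start \<open>k = 0\<close> is the convergence of the coarse method, whose
  one-step defect is $o(\tau)$ by (ii) and the consistency at zero.
\<close>

section \<open>Fourier series on the torus\<close>

lemma freq_sq_nonneg [simp]: "0 \<le> freq_sq k"
  by (simp add: freq_sq_def sum_nonneg)

section \<open>Summability of the weights (1 + |k|^2)^(-r) for r > d/2\<close>

text \<open>Comparison with the series of \<open>n powr (-2*p)\<close>, which converges since
  \<open>2*p > 1\<close>, on each of the two half-lines that cover the integers.\<close>

lemma summable_on_int_powr:
  assumes "p > 1/2"
  shows "(\<lambda>m::int. (1 + (real_of_int m)\<^sup>2) powr (-p)) summable_on UNIV"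
proof -
  let ?f = "\<lambda>m::int. (1 + (real_of_int m)\<^sup>2) powr (-p)"
  have le: "(1 + (real n)\<^sup>2) powr (-p) \<le> real n powr (-2*p)" if "n \<ge> 1" for n :: nat
  proof -
    have "real n powr (-2*p) = (real n powr 2) powr (-p)"
      by (subst powr_powr) simp
    also have "\<dots> = ((real n)\<^sup>2) powr (-p)"
      using that by (simp add: powr_numeral)
    finally show ?thesis
      using that assms by (auto intro!: powr_mono2')
  qed
  have "summable (\<lambda>n. real n powr (-2*p))"
    using assms by (simp add: summable_real_powr_iff)
  then have "summable (\<lambda>n. (1 + (real n)\<^sup>2) powr (-p))"
    by (rule summable_comparison_test_ev[rotated])
       (use le in \<open>auto simp: eventually_sequentially intro!: exI[of _ 1]\<close>)
  then have nat: "(\<lambda>n::nat. (1 + (real n)\<^sup>2) powr (-p)) summable_on UNIV"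
    by (intro norm_summable_imp_summable_on) simp
  have "?f summable_on range int" "?f summable_on range (\<lambda>n. - int n)"
    using nat by (subst summable_on_reindex; simp add: o_def inj_on_def)+
  then have "?f summable_on (range int \<union> range (\<lambda>n. - int n))"
    by (rule summable_on_union)
  moreover have "range int \<union> range (\<lambda>n. - int n) = UNIV"
  proof -
    have "m \<in> range int \<union> range (\<lambda>n. - int n)" for m
      by (cases m rule: int_cases2) auto
    then show ?thesis by blast
  qed
  ultimately show ?thesis by simp
qed

text \<open>The exponent is shared equally among the d coordinates, \<open>p = r / d > 1/2\<close>,
  so the sum over frequency vectors is dominated by the d-th power of a convergent sum over the
  integers.\<close>

lemma freq_weight_summable:
  assumes r: "r > real CARD('n) / 2"
  shows "(\<lambda>k::int^'n::finite. (1 + freq_sq k) powr (-r)) summable_on UNIV"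
proof -
  define p where "p = r / real CARD('n)"
  have p: "p > 1/2"
    using r by (simp add: p_def field_simps)
  define g where "g = (\<lambda>m::int. (1 + (real_of_int m)\<^sup>2) powr (-p))"
  have g: "g summable_on UNIV" "\<And>m. 0 \<le> g m"
    using summable_on_int_powr[OF p] by (auto simp: g_def)
  \<comment> \<open>$1 + |k|^2$ is at least each $1 + k_j^2$, hence at least their geometric mean.\<close>
  have le: "(1 + freq_sq k) powr (-r) \<le> (\<Prod>j\<in>UNIV. g (k $ j))" for k :: "int^'n"
  proof -
    have "(1 + freq_sq k) powr (-r) = (\<Prod>j\<in>(UNIV::'n set). (1 + freq_sq k) powr (-p))"
      using freq_sq_nonneg[of k, THEN add_pos_nonneg[OF zero_less_one]] by (subst prod_constant, subst powr_power) (auto simp: p_def)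
    also have "\<dots> \<le> (\<Prod>j\<in>UNIV. g (k $ j))"
      unfolding g_def freq_sq_def using p
      by (intro prod_mono conjI powr_mono2' add_left_mono member_le_sum) (auto simp: add_pos_nonneg)
    finally show ?thesis .
  qed
  have "sum (\<lambda>k::int^'n. (1 + freq_sq k) powr (-r)) K \<le> infsum g UNIV ^ CARD('n)" if "finite K" for K
  proof -
    \<comment> \<open>All entries of vectors in \<open>K\<close> lie in \<open>A\<close>, so
      \<open>K\<close> sits inside the finite cube of vectors with entries in \<open>A\<close>; over
      a cube the sum of products factors into a product of sums.\<close>
    define A where "A = (\<Union>k\<in>K. range (($) k))"
    have A: "finite A"
      using that by (auto simp: A_def)
    have inj: "inj_on vec_lambda (PiE (UNIV::'n set) (\<lambda>_. A))"
      by (auto simp: inj_on_def vec_lambda_inject)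
    have sub: "K \<subseteq> vec_lambda ` PiE UNIV (\<lambda>_. A)"
    proof
      fix k assume "k \<in> K"
      then have "k = vec_lambda (($) k)" "($) k \<in> PiE UNIV (\<lambda>_. A)"
        by (auto simp: A_def)
      then show "k \<in> vec_lambda ` PiE UNIV (\<lambda>_. A)" by blast
    qed
    have "sum (\<lambda>k::int^'n. (1 + freq_sq k) powr (-r)) K \<le> (\<Sum>k\<in>K. \<Prod>j\<in>UNIV. g (k $ j))"
      by (intro sum_mono le)
    also have "\<dots> \<le> (\<Sum>k\<in>vec_lambda ` PiE (UNIV::'n set) (\<lambda>_. A). \<Prod>j\<in>UNIV. g (k $ j))"
    proof (rule sum_mono2)
      show "finite (vec_lambda ` PiE (UNIV :: 'n set) (\<lambda>_. A))"
        using A by (intro finite_imageI finite_PiE) auto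
    qed (use sub g in \<open>auto intro: prod_nonneg\<close>)
    also have "\<dots> = (\<Sum>h\<in>PiE (UNIV::'n set) (\<lambda>_. A). \<Prod>j\<in>(UNIV::'n set). g (h j))"
      by (simp add: sum.reindex[OF inj])
    also have "\<dots> = (\<Prod>j\<in>(UNIV::'n set). sum g A)"
      using A by (subst prod_sum_PiE) auto
    also have "\<dots> \<le> infsum g UNIV ^ CARD('n)"
      using A g by (auto intro!: power_mono finite_sum_le_infsum sum_nonneg)
    finally show ?thesis .
  qed
  then show ?thesis
    by (intro nonneg_bdd_above_summable_on bdd_aboveI2) auto
qed

section \<open>Orthogonality of the characters over the period cell\<close>

text \<open>For \<open>q \<noteq> 0\<close> the antiderivative has equal values at both ends of the
  period. The Lebesgue integral over the line with an indicator is the form in which one coordinate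
  enters the product measure in \<open>integral_box_character\<close>.\<close>

lemma cis_integral_period:
  "(LBINT t. indicator {0<..<2*pi} t *\<^sub>R cis (real_of_int q * t)) = (if q = 0 then complex_of_real (2*pi) else 0)"
proof -
  have "continuous_on {0..2*pi} (\<lambda>t. cis (real_of_int q * t))"
    by (intro continuous_intros)
  then have si: "set_integrable lborel {0..2*pi} (\<lambda>t. cis (real_of_int q * t))"
    by (rule borel_integrable_atLeastAtMost')
  then have si': "set_integrable lborel {0<..<2*pi} (\<lambda>t. cis (real_of_int q * t))"
    by (rule set_integrable_subset) auto
  have "((\<lambda>t. cis (real_of_int q * t)) has_integral (if q = 0 then complex_of_real (2*pi) else 0)) {0..2*pi}"
  proof (cases "q = 0")
    case True
    then show ?thesis
      using has_integral_const_real[of "1::complex" 0 "2*pi"] by (simp add: scaleR_conv_of_real)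
  next
    case False
    have "((\<lambda>z. exp (\<i> * of_int q * z) / (\<i> * of_int q)) has_field_derivative exp (\<i> * of_int q * z)) (at z)"
      for z :: complex
      using False by (auto intro!: derivative_eq_intros)
    then have "((\<lambda>t. exp (\<i> * of_int q * of_real t) / (\<i> * of_int q)) has_vector_derivative
        exp (\<i> * of_int q * of_real t)) (at t within {0..2*pi})" for t :: real
      by (rule has_vector_derivative_real_field[where f = "\<lambda>z. exp (\<i> * of_int q * z) / (\<i> * of_int q)"])
    then have "((\<lambda>t. cis (real_of_int q * t) / (\<i> * of_int q)) has_vector_derivative
        cis (real_of_int q * t)) (at t within {0..2*pi})" for t
      by (simp add: cis_conv_exp mult.assoc)
    then have "((\<lambda>t. cis (real_of_int q * t)) has_integral
        (cis (real_of_int q * (2*pi)) / (\<i> * of_int q) - cis (real_of_int q * 0) / (\<i> * of_int q))) {0..2*pi}"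
      by (intro fundamental_theorem_of_calculus) auto
    moreover have "cis (real_of_int q * (2*pi)) = 1"
      using cis_multiple_2pi[of "real_of_int q"] by (simp add: mult_ac)
    ultimately show ?thesis using False by simp
  qed
  then have "integral {0<..<2*pi} (\<lambda>t. cis (real_of_int q * t)) = (if q = 0 then complex_of_real (2*pi) else 0)"
    using integral_open_interval[of 0 "2*pi" "\<lambda>t. cis (real_of_int q * t)"] by (simp add: box_real integral_unique)
  then show ?thesis
    using set_borel_integral_eq_integral(2)[OF si'] by (simp add: set_lebesgue_integral_def)
qed


text \<open>Fubini: the indicator of the box and the character are both products over the
  coordinates, so the integral is a product of one-dimensional integrals, which vanishes unless
  every entry of \<open>q\<close> is 0.\<close>

lemma integral_box_character:
  "integral (box 0 (\<chi> j. 2 * pi)) (\<lambda>x. cis (freq_inner q x)) =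
     (if q = 0 then of_real ((2 * pi) ^ CARD('n)) else 0)" for q :: "int^'n::finite"
proof -
  let ?B = "box 0 (\<chi> j. 2 * pi) :: (real^'n) set"
  define Q :: "real^'n" where "Q = (\<chi> j. real_of_int (q $ j))"
  \<comment> \<open>The factors are indexed by basis vectors because \<open>lborel_eq\<close>
    presents Lebesgue measure as the image of a product measure over \<open>Basis\<close>;
    \<open>Q \<bullet> b\<close> recovers the matching entry of \<open>q\<close>.\<close>
  define G where "G = (\<lambda>(b::real^'n) t. indicator {0<..<2*pi} t *\<^sub>R cis ((Q \<bullet> b) * t))"
  have B: "(Basis :: (real^'n) set) = range (\<lambda>j. axis j 1)"
    by (auto simp: Basis_vec_def)
  have inj: "inj (\<lambda>j. axis j (1::real) :: real^'n)"
    by (auto simp: inj_on_def axis_eq_axis)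
  have Gint: "integral\<^sup>L lborel (G (axis j 1)) = (if q $ j = 0 then complex_of_real (2*pi) else 0)" for j
    using cis_integral_period[of "q $ j"] by (simp add: G_def Q_def inner_axis)
  have Gable: "integrable lborel (G b)" for b
  proof -
    have "set_integrable lborel {0..2*pi} (\<lambda>t. cis ((Q \<bullet> b) * t))"
      by (intro borel_integrable_atLeastAtMost' continuous_intros)
    then have "set_integrable lborel {0<..<2*pi} (\<lambda>t. cis ((Q \<bullet> b) * t))"
      by (rule set_integrable_subset) auto
    then show ?thesis by (simp add: G_def set_integrable_def)
  qed
  have prod: "indicator ?B x *\<^sub>R cis (freq_inner q x) = (\<Prod>b\<in>Basis. G b (x \<bullet> b))" for x
  proof -
    have "indicator ?B x = (\<Prod>j\<in>UNIV. indicator {0<..<2*pi} (x $ j) :: real)"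
      by (auto simp: indicator_def mem_box_cart prod_zero_iff)
    moreover have "cis (freq_inner q x) = (\<Prod>j\<in>UNIV. cis (real_of_int (q $ j) * x $ j))"
      by (simp add: freq_inner_def cis_conv_exp exp_sum sum_distrib_left)
    ultimately show ?thesis
      by (simp add: B prod.reindex[OF inj] G_def Q_def inner_axis scaleR_conv_of_real prod.distrib)
  qed
  have "continuous_on (cbox 0 (\<chi> j. 2 * pi)) (\<lambda>x. cis (freq_inner q x))"
    unfolding freq_inner_def by (intro continuous_intros)
  then have "set_integrable lborel (cbox 0 (\<chi> j. 2 * pi)) (\<lambda>x. cis (freq_inner q x))"
    unfolding set_integrable_def by (intro borel_integrable_compact) auto
  then have si: "set_integrable lborel ?B (\<lambda>x. cis (freq_inner q x))"
    by (rule set_integrable_subset) (auto simp: box_subset_cbox)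
  interpret product_sigma_finite "\<lambda>_::real^'n. lborel :: real measure"
    by standard
  have [measurable]: "G b \<in> borel_measurable borel" for b
    using borel_measurable_integrable[OF Gable[of b]] by simp
  have "integral ?B (\<lambda>x. cis (freq_inner q x)) = (LINT x|lborel. (\<Prod>b\<in>Basis. G b (x \<bullet> b)))"
    using set_borel_integral_eq_integral(2)[OF si] by (simp add: set_lebesgue_integral_def prod)
  also have "\<dots> = (LINT f|(\<Pi>\<^sub>M b\<in>Basis. lborel). (\<Prod>b\<in>Basis. G b ((\<Sum>i\<in>Basis. f i *\<^sub>R i) \<bullet> b)))"
    by (subst lborel_eq) (simp add: integral_distr)
  also have "\<dots> = (LINT f|(\<Pi>\<^sub>M b\<in>Basis. lborel). (\<Prod>b\<in>Basis. G b (f b)))"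
    by simp
  also have "\<dots> = (\<Prod>b\<in>Basis. integral\<^sup>L lborel (G b))"
    by (intro product_integral_prod Gable) auto
  also have "\<dots> = (\<Prod>j\<in>UNIV. if q $ j = 0 then complex_of_real (2*pi) else 0)"
    by (simp add: B prod.reindex[OF inj] Gint)
  also have "\<dots> = (if q = 0 then of_real ((2 * pi) ^ CARD('n)) else 0)"
    by (auto simp: vec_eq_iff prod_zero_iff)
  finally show ?thesis .
qed

section \<open>Termwise integration of absolutely convergent Fourier series\<close>

lemma integrable_on_open_box:
  fixes f :: "'a::euclidean_space \<Rightarrow> 'b::banach"
  shows "f integrable_on cbox a b \<Longrightarrow> f integrable_on box a b"
  by (simp add: integrable_on_open_interval)

lemma finite_to_nat_less: "finite {k::'a::countable. to_nat k < n}"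
  using finite_vimageI[of "{..<n}" "to_nat :: 'a \<Rightarrow> nat"] by (simp add: vimage_def)

text \<open>The sets of indices with code below \<open>n\<close> eventually contain any given finite
  set. This replaces the unordered sum by a limit of a sequence, as dominated convergence
  requires.\<close>

lemma partial_sums_tendsto_infsum:
  fixes f :: "'a::countable \<Rightarrow> 'b::{comm_monoid_add,t2_space}"
  assumes "f summable_on UNIV"
  shows "(\<lambda>n. sum f {k. to_nat k < n}) \<longlonglongrightarrow> infsum f UNIV"
proof -
  have "filterlim (\<lambda>n. {k::'a. to_nat k < n}) (finite_subsets_at_top UNIV) sequentially"
    unfolding filterlim_iff eventually_finite_subsets_at_top
  proof safe
    fix P and X :: "'a set"
    assume "finite X" and P: "\<forall>Y. finite Y \<and> X \<subseteq> Y \<and> Y \<subseteq> UNIV \<longrightarrow> P Y"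
    then obtain N where "\<And>x. x \<in> X \<Longrightarrow> to_nat x < N"
      using finite_nat_set_iff_bounded[of "to_nat ` X"] by auto
    then have "P {k::'a. to_nat k < n}" if "n \<ge> N" for n
      using finite_to_nat_less that by (intro P[rule_format]) (auto intro: less_le_trans)
    then show "\<forall>\<^sub>F n in sequentially. P {k::'a. to_nat k < n}"
      by (auto simp: eventually_sequentially)
  qed
  moreover have "(sum f \<longlongrightarrow> infsum f UNIV) (finite_subsets_at_top UNIV)"
    using has_sum_infsum[OF assms] by (simp add: has_sum_def)
  ultimately show ?thesis
    using filterlim_compose by blast
qed

lemma freq_inner_diff: "freq_inner (k - m) x = freq_inner k x - freq_inner m x"
  by (simp add: freq_inner_def left_diff_distrib sum_subtractf)

lemma continuous_on_freq_inner [continuous_intros]: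
  "continuous_on A f \<Longrightarrow> continuous_on A (\<lambda>x. freq_inner k (f x))"
  unfolding freq_inner_def by (intro continuous_intros)

lemma cis_freq_inner_shift: "cis (freq_inner k (x + axis j (2 * pi))) = cis (freq_inner k x)"
proof -
  have "freq_inner k (x + axis j (2 * pi)) =
      freq_inner k x + (\<Sum>i\<in>UNIV. if i = j then real_of_int (k $ i) * (2 * pi) else 0)"
    unfolding freq_inner_def sum.distrib[symmetric]
    by (intro sum.cong) (auto simp: axis_def distrib_left)
  then have "freq_inner k (x + axis j (2 * pi)) = freq_inner k x + 2 * pi * real_of_int (k $ j)"
    by simp
  then show ?thesis
    by (simp add: cis_mult[symmetric] cis_multiple_2pi)
qed

lemma trig_terms_summable:
  assumes "(\<lambda>k. norm (a k)) summable_on UNIV"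
  shows "(\<lambda>k. a k * cis (\<theta> k)) summable_on UNIV"
  by (rule abs_summable_summable) (use assms in \<open>simp add: norm_mult\<close>)

lemma trig_series_continuous:
  assumes "(\<lambda>k. norm (a k)) summable_on UNIV"
  shows "continuous_on A (\<lambda>x. \<Sum>\<^sub>\<infinity>k. a k * cis (freq_inner k x))"
proof (rule uniform_limit_theorem)
  show "uniform_limit A (\<lambda>K x. \<Sum>k\<in>K. a k * cis (freq_inner k x))
      (\<lambda>x. \<Sum>\<^sub>\<infinity>k. a k * cis (freq_inner k x)) (finite_subsets_at_top UNIV)"
    using assms by (intro Weierstrass_m_test_general) (auto simp: norm_mult)
  show "\<forall>\<^sub>F K in finite_subsets_at_top UNIV. continuous_on A (\<lambda>x. \<Sum>k\<in>K. a k * cis (freq_inner k x))"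
    by (intro always_eventually allI continuous_intros)
qed simp

text \<open>Dominated convergence with the constant majorant given by the sum of all
  \<open>norm (a k)\<close> allows termwise integration, and orthogonality leaves only the term
  \<open>k = m\<close>.\<close>

lemma trig_series_coeff:
  fixes a :: "int^'n::finite \<Rightarrow> complex"
  assumes a: "(\<lambda>k. norm (a k)) summable_on UNIV"
  shows "fourier_coeff (\<lambda>x. \<Sum>\<^sub>\<infinity>k. a k * cis (freq_inner k x)) m = a m"
proof -
  let ?B = "box 0 (\<chi> j. 2 * pi) :: (real^'n) set"
  let ?I = "\<lambda>k. integral ?B (\<lambda>x. cis (freq_inner k x))"
  have int: "(\<lambda>x. cis (freq_inner k x)) integrable_on ?B" for k :: "int^'n"
    by (intro integrable_on_open_box integrable_continuous continuous_intros)
  have conv: "(\<lambda>n. \<Sum>k | to_nat k < n. a k * cis (freq_inner (k - m) x)) \<longlonglongrightarrow>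
      (\<Sum>\<^sub>\<infinity>k. a k * cis (freq_inner k x)) * cis (- freq_inner m x)" for x
  proof -
    have "(\<lambda>n. (\<Sum>k | to_nat k < n. a k * cis (freq_inner k x)) * cis (- freq_inner m x)) \<longlonglongrightarrow>
      (\<Sum>\<^sub>\<infinity>k. a k * cis (freq_inner k x)) * cis (- freq_inner m x)"
      by (intro tendsto_mult_right partial_sums_tendsto_infsum trig_terms_summable a)
    then show ?thesis
      by (simp add: sum_distrib_right mult.assoc cis_mult freq_inner_diff)
  qed
  have "(\<lambda>n. integral ?B (\<lambda>x. \<Sum>k | to_nat k < n. a k * cis (freq_inner (k - m) x))) \<longlonglongrightarrow>
      integral ?B (\<lambda>x. (\<Sum>\<^sub>\<infinity>k. a k * cis (freq_inner k x)) * cis (- freq_inner m x))"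
  proof (rule dominated_convergence(2)[where h = "\<lambda>_. \<Sum>\<^sub>\<infinity>k. norm (a k)"])
    show "(\<lambda>_. \<Sum>\<^sub>\<infinity>k. norm (a k)) integrable_on ?B"
      by (intro integrable_on_open_box integrable_continuous continuous_intros)
    fix n and x :: "real^'n"
    have "norm (\<Sum>k | to_nat k < n. a k * cis (freq_inner (k - m) x)) \<le> (\<Sum>k | to_nat k < n. norm (a k))"
      by (rule sum_norm_le) (simp add: norm_mult)
    also have "\<dots> \<le> (\<Sum>\<^sub>\<infinity>k. norm (a k))"
      using a finite_to_nat_less by (intro finite_sum_le_infsum) auto
    finally show "norm (\<Sum>k | to_nat k < n. a k * cis (freq_inner (k - m) x)) \<le> (\<Sum>\<^sub>\<infinity>k. norm (a k))" .
  qed (use conv in \<open>auto intro!: integrable_sum integrable_on_mult_right int finite_to_nat_less\<close>)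
  \<comment> \<open>As soon as the frequency \<open>m\<close> belongs to the partial sum, the
    integral no longer changes, so the sequence is eventually constant.\<close>
  moreover have "integral ?B (\<lambda>x. \<Sum>k | to_nat k < n. a k * cis (freq_inner (k - m) x)) =
      a m * of_real ((2 * pi) ^ CARD('n))" if "n > to_nat m" for n
  proof -
    have "integral ?B (\<lambda>x. \<Sum>k | to_nat k < n. a k * cis (freq_inner (k - m) x)) =
        (\<Sum>k | to_nat k < n. a k * ?I (k - m))"
      by (subst integral_sum) (auto intro!: integrable_on_mult_right int finite_to_nat_less)
    also have "\<dots> = (\<Sum>k | to_nat k < n. if k = m then a m * of_real ((2 * pi) ^ CARD('n)) else 0)"
      by (intro sum.cong) (auto simp: integral_box_character)
    also have "\<dots> = a m * of_real ((2 * pi) ^ CARD('n))"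
      using that by (simp add: finite_to_nat_less)
    finally show ?thesis .
  qed
  then have "\<forall>\<^sub>F n in sequentially. integral ?B (\<lambda>x. \<Sum>k | to_nat k < n. a k * cis (freq_inner (k - m) x)) =
      a m * of_real ((2 * pi) ^ CARD('n))"
    by (auto simp: eventually_sequentially intro!: exI[of _ "Suc (to_nat m)"])
  ultimately have "integral ?B (\<lambda>x. (\<Sum>\<^sub>\<infinity>k. a k * cis (freq_inner k x)) * cis (- freq_inner m x)) =
      a m * of_real ((2 * pi) ^ CARD('n))"
    by (rule LIMSEQ_unique[OF _ tendsto_eventually])
  then show ?thesis
    by (simp add: fourier_coeff_def)
qed

lemma fourier_coeff_add:
  fixes v w :: "'n::finite torus_fun"
  assumes "continuous_on UNIV v" "continuous_on UNIV w"
  shows "fourier_coeff (v + w) k = fourier_coeff v k + fourier_coeff w k"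
proof -
  have "(\<lambda>x. f x * cis (- freq_inner k x)) integrable_on box 0 (\<chi> j. 2 * pi)"
    if "continuous_on UNIV f" for f :: "'n torus_fun"
    using that
    by (intro integrable_on_open_box integrable_continuous continuous_intros)
       (auto intro: continuous_on_subset)
  with assms show ?thesis
    by (simp add: fourier_coeff_def distrib_right integral_add add_divide_distrib)
qed

lemma fourier_coeff_uminus: "fourier_coeff (- v) k = - fourier_coeff v k"
  by (simp add: fourier_coeff_def)

section \<open>Sobolev norms and the Schroedinger group\<close>

lemma freq_weight_pos [simp]: "0 < 1 + freq_sq k"
  by (rule add_pos_nonneg) auto

lemma freq_weight_half_squared: "((1 + freq_sq k) powr (r / 2))\<^sup>2 = (1 + freq_sq k) powr r"
  by (simp add: power2_eq_square powr_add[symmetric])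

lemma sobolev_norm_nonneg [simp]: "0 \<le> sobolev_norm r v"
  by (simp add: sobolev_norm_def infsum_nonneg)

lemma weighted_sum_le_sobolev_norm:
  assumes "v \<in> sobolev r" "finite K"
  shows "(\<Sum>k\<in>K. (1 + freq_sq k) powr r * (cmod (fourier_coeff v k))\<^sup>2) \<le> (sobolev_norm r v)\<^sup>2"
  using assms by (auto simp: sobolev_norm_def infsum_nonneg sobolev_def intro!: finite_sum_le_infsum)

text \<open>Reduces membership and the norm bound to finite sums, where Minkowski's inequality for
  \<open>L2_set\<close> is available.\<close>

lemma sobolevI:
  assumes "continuous_on UNIV v" "periodic v" "0 \<le> B"
    and B: "\<And>K. finite K \<Longrightarrow> (\<Sum>k\<in>K. (1 + freq_sq k) powr r * (cmod (fourier_coeff v k))\<^sup>2) \<le> B\<^sup>2"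
  shows "v \<in> sobolev r" "sobolev_norm r v \<le> B"
proof -
  let ?f = "\<lambda>k. (1 + freq_sq k) powr r * (cmod (fourier_coeff v k))\<^sup>2"
  have f: "?f summable_on UNIV"
    using B by (intro nonneg_bdd_above_summable_on bdd_aboveI2[where M = "B\<^sup>2"]) auto
  then show "v \<in> sobolev r"
    using assms by (simp add: sobolev_def)
  have "infsum ?f UNIV \<le> B\<^sup>2"
    using f B by (intro infsum_le_finite_sums) auto
  then show "sobolev_norm r v \<le> B"
    using \<open>0 \<le> B\<close> by (simp add: sobolev_norm_def real_le_lsqrt)
qed

text \<open>Minkowski's inequality on finite sets of frequencies. The auxiliary \<open>h\<close>
  carries the square root of the weight, so that \<open>L2_set (h f)\<close> is a truncated Sobolev
  norm.\<close>

lemma sobolev_add: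
  fixes v w :: "'n::finite torus_fun"
  assumes v: "v \<in> sobolev r" and w: "w \<in> sobolev r"
  shows "v + w \<in> sobolev r" and "sobolev_norm r (v + w) \<le> sobolev_norm r v + sobolev_norm r w"
proof -
  define h where "h = (\<lambda>(f :: 'n torus_fun) k. (1 + freq_sq k) powr (r / 2) * cmod (fourier_coeff f k))"
  have sq: "(h f k)\<^sup>2 = (1 + freq_sq k) powr r * (cmod (fourier_coeff f k))\<^sup>2" for f k
    by (simp add: h_def power_mult_distrib freq_weight_half_squared)
  have h0: "0 \<le> h f k" for f k
    by (simp add: h_def)
  have cont: "continuous_on UNIV v" "continuous_on UNIV w" and per: "periodic v" "periodic w"
    using v w by (auto simp: sobolev_def)
  have le: "L2_set (h f) K \<le> sobolev_norm r f" if "f \<in> sobolev r" "finite K" for f K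
    using weighted_sum_le_sobolev_norm[OF that]
    by (simp add: L2_set_def sq real_le_lsqrt)
  have "(\<Sum>k\<in>K. (1 + freq_sq k) powr r * (cmod (fourier_coeff (v + w) k))\<^sup>2)
      \<le> (sobolev_norm r v + sobolev_norm r w)\<^sup>2" if "finite K" for K
  proof -
    have "h (v + w) k \<le> h v k + h w k" for k
      using norm_triangle_ineq[of "fourier_coeff v k" "fourier_coeff w k"]
      by (simp add: h_def fourier_coeff_add[OF cont] distrib_left[symmetric] mult_left_mono)
    then have "L2_set (h (v + w)) K \<le> L2_set (\<lambda>k. h v k + h w k) K"
      by (intro L2_set_mono) (auto simp: h0)
    also have "\<dots> \<le> L2_set (h v) K + L2_set (h w) K"
      by (rule L2_set_triangle_ineq)
    also have "\<dots> \<le> sobolev_norm r v + sobolev_norm r w"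
      using le v w that by (intro add_mono) auto
    finally have "(L2_set (h (v + w)) K)\<^sup>2 \<le> (sobolev_norm r v + sobolev_norm r w)\<^sup>2"
      by (intro power_mono) auto
    then show ?thesis
      by (simp add: L2_set_def sq[symmetric] sum_nonneg)
  qed
  moreover have "continuous_on UNIV (v + w)"
    using cont unfolding plus_fun_def by (intro continuous_intros)
  moreover have "periodic (v + w)"
    using per by (simp add: periodic_def)
  ultimately show "v + w \<in> sobolev r" "sobolev_norm r (v + w) \<le> sobolev_norm r v + sobolev_norm r w"
    using sobolevI[of "v + w" "sobolev_norm r v + sobolev_norm r w" r] by auto
qed

lemma sobolev_norm_uminus [simp]: "sobolev_norm r (- v) = sobolev_norm r v"
  by (simp add: sobolev_norm_def fourier_coeff_uminus)

lemma sobolev_uminus: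
  assumes "v \<in> sobolev r"
  shows "- v \<in> sobolev r"
proof -
  have "continuous_on UNIV (- v)"
    unfolding fun_Compl_def using assms by (intro continuous_on_minus) (simp add: sobolev_def)
  then show ?thesis
    using assms by (simp add: sobolev_def fourier_coeff_uminus periodic_def)
qed

lemma sobolev_diff:
  assumes "v \<in> sobolev r" "w \<in> sobolev r"
  shows "v - w \<in> sobolev r" and "sobolev_norm r (v - w) \<le> sobolev_norm r v + sobolev_norm r w"
  using sobolev_add[OF assms(1) sobolev_uminus[OF assms(2)]] by auto

lemma zero_in_sobolev: "0 \<in> sobolev r" and sobolev_norm_zero [simp]: "sobolev_norm r 0 = 0"
  by (auto simp: sobolev_def sobolev_norm_def fourier_coeff_def periodic_def zero_fun_def)

lemma fourier_coeff_diff: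
  assumes "continuous_on UNIV v" "continuous_on UNIV w"
  shows "fourier_coeff (v - w) k = fourier_coeff v k - fourier_coeff w k"
proof -
  have "continuous_on UNIV (- w)"
    using assms(2) by (simp add: fun_Compl_def continuous_on_minus)
  from fourier_coeff_add[OF assms(1) this] show ?thesis
    by (simp add: fourier_coeff_uminus)
qed

text \<open>For \<open>r \<ge> 0\<close> all weights are at least 1, so a single term of the norm
  suffices. Hence each coefficient of a continuous curve in H^r is continuous in time.\<close>

lemma fourier_coeff_le_sobolev_norm:
  assumes "v \<in> sobolev r" "0 \<le> r"
  shows "cmod (fourier_coeff v k) \<le> sobolev_norm r v"
proof -
  have "1 \<le> (1 + freq_sq k) powr r"
    using assms(2) by (intro ge_one_powr_ge_zero) auto
  then have "(cmod (fourier_coeff v k))\<^sup>2 \<le> (1 + freq_sq k) powr r * (cmod (fourier_coeff v k))\<^sup>2"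
    using mult_right_mono[of 1 _ "(cmod (fourier_coeff v k))\<^sup>2"] by simp
  also have "\<dots> \<le> (sobolev_norm r v)\<^sup>2"
    using weighted_sum_le_sobolev_norm[OF assms(1), of "{k}"] by simp
  finally show ?thesis
    by (rule power2_le_imp_le) simp
qed

text \<open>The inequality 2xy \<le> x^2 + y^2 splits a coefficient into a pure weight, summable for
  r > d/2, and a term of the Sobolev norm. The resulting bound is uniform on balls of H^r.\<close>

lemma fourier_coeff_summable:
  fixes v :: "'n::finite torus_fun"
  assumes r: "r > real CARD('n) / 2" and v: "v \<in> sobolev r"
  shows "(\<lambda>k. cmod (fourier_coeff v k)) summable_on UNIV"
    and "(\<Sum>\<^sub>\<infinity>k. cmod (fourier_coeff v k)) \<le> (\<Sum>\<^sub>\<infinity>k::int^'n. (1 + freq_sq k) powr (-r)) + (sobolev_norm r v)\<^sup>2"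
proof -
  define g where "g = (\<lambda>k. (1 + freq_sq k) powr (-r) + (1 + freq_sq k) powr r * (cmod (fourier_coeff v k))\<^sup>2)"
  have le: "cmod (fourier_coeff v k) \<le> g k" for k
  proof -
    define a where "a = (1 + freq_sq k) powr (r/2)"
    define c where "c = cmod (fourier_coeff v k)"
    have a: "a > 0"
      using freq_weight_pos[of k] by (simp add: a_def del: freq_weight_pos)
    have "g k = (1 / a)\<^sup>2 + (a * c)\<^sup>2"
      by (simp add: g_def a_def c_def power_divide power_mult_distrib freq_weight_half_squared powr_minus_divide)
    moreover have "2 * c \<le> (1 / a)\<^sup>2 + (a * c)\<^sup>2"
      using sum_squares_bound[of "1 / a" "a * c"] a by simp
    moreover have "c \<ge> 0"
      by (simp add: c_def)
    ultimately show ?thesis by (simp only: c_def)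
  qed
  have s: "(\<lambda>k::int^'n. (1 + freq_sq k) powr (-r)) summable_on UNIV"
      "(\<lambda>k. (1 + freq_sq k) powr r * (cmod (fourier_coeff v k))\<^sup>2) summable_on UNIV"
    using freq_weight_summable[OF r] v by (auto simp: sobolev_def)
  have g: "g summable_on UNIV"
    unfolding g_def using s by (rule summable_on_add)
  show c: "(\<lambda>k. cmod (fourier_coeff v k)) summable_on UNIV"
    using le by (intro summable_on_comparison_test[OF g]) auto
  have "(\<Sum>\<^sub>\<infinity>k. cmod (fourier_coeff v k)) \<le> infsum g UNIV"
    using le by (intro infsum_mono c g) auto
  also have "\<dots> = (\<Sum>\<^sub>\<infinity>k::int^'n. (1 + freq_sq k) powr (-r)) + (sobolev_norm r v)\<^sup>2"
    unfolding g_def using s by (subst infsum_add) (auto simp: sobolev_norm_def infsum_nonneg)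
  finally show "(\<Sum>\<^sub>\<infinity>k. cmod (fourier_coeff v k)) \<le> (\<Sum>\<^sub>\<infinity>k::int^'n. (1 + freq_sq k) powr (-r)) + (sobolev_norm r v)\<^sup>2" .
qed

section \<open>Isometry of the Schroedinger group on H^r\<close>

context
  fixes r :: real and v :: "'n::finite torus_fun"
  assumes r: "r > real CARD('n) / 2" and v: "v \<in> sobolev r"
begin

lemma group_coeff_summable:
  "(\<lambda>k. cmod (cis (- t * freq_sq k) * fourier_coeff v k)) summable_on UNIV"
  using fourier_coeff_summable(1)[OF r v] by (simp add: norm_mult)

text \<open>An absolutely convergent series has the coefficients it is written with. Since the
  multipliers have modulus 1, isometry and invariance of \<open>sobolev r\<close> follow.\<close>

lemma fourier_coeff_schroedinger_group:
  "fourier_coeff (schroedinger_group t v) k = cis (- t * freq_sq k) * fourier_coeff v k"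
  unfolding schroedinger_group_def by (rule trig_series_coeff[OF group_coeff_summable])

lemma sobolev_norm_schroedinger_group [simp]:
  "sobolev_norm r (schroedinger_group t v) = sobolev_norm r v"
  by (simp add: sobolev_norm_def fourier_coeff_schroedinger_group norm_mult)

lemma schroedinger_group_sobolev: "schroedinger_group t v \<in> sobolev r"
proof -
  have "continuous_on UNIV (schroedinger_group t v)"
    unfolding schroedinger_group_def by (rule trig_series_continuous[OF group_coeff_summable])
  moreover have "periodic (schroedinger_group t v)"
    by (simp add: periodic_def schroedinger_group_def cis_freq_inner_shift)
  ultimately show ?thesis
    using v by (simp add: sobolev_def fourier_coeff_schroedinger_group norm_mult)
qed

end

lemma schroedinger_group_diff:
  fixes v w :: "'n::finite torus_fun"
  assumes r: "r > real CARD('n) / 2" and v: "v \<in> sobolev r" and w: "w \<in> sobolev r"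
  shows "schroedinger_group t (v - w) = schroedinger_group t v - schroedinger_group t w"
proof
  fix x :: "real^'n"
  have s: "(\<lambda>k. cis (- t * freq_sq k) * fourier_coeff f k * cis (freq_inner k x)) summable_on UNIV"
    if "f \<in> sobolev r" for f
    by (rule trig_terms_summable[OF group_coeff_summable[OF r that]])
  have "continuous_on UNIV v" "continuous_on UNIV w"
    using v w by (auto simp: sobolev_def)
  then show "schroedinger_group t (v - w) x = (schroedinger_group t v - schroedinger_group t w) x"
    using infsum_add[OF s[OF v] s[OF sobolev_uminus[OF w]]]
    by (simp add: schroedinger_group_def fourier_coeff_diff fourier_coeff_uminus infsum_uminus algebra_simps)
qed

section \<open>Time shifts of exact solutions\<close>

text \<open>Reverse triangle inequality, obtained from \<open>sobolev_add\<close> for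
  \<open>u s = (u s - u t) + u t\<close> and the same with \<open>s\<close> and \<open>t\<close>
  exchanged.\<close>

lemma sobolev_norm_continuous:
  assumes "sobolev_curve r T u"
  shows "continuous_on {0..T} (\<lambda>t. sobolev_norm r (u t))"
  unfolding continuous_on_def
proof
  fix t assume t: "t \<in> {0..T}"
  have "\<bar>sobolev_norm r (u s) - sobolev_norm r (u t)\<bar> \<le> sobolev_norm r (u s - u t)" if "s \<in> {0..T}" for s
  proof -
    have m: "u s \<in> sobolev r" "u t \<in> sobolev r"
      using assms t that by (auto simp: sobolev_curve_def)
    have "sobolev_norm r (u t - u s) = sobolev_norm r (u s - u t)"
      using sobolev_norm_uminus[of r "u s - u t"] by simp
    then show ?thesis
      using sobolev_add(2)[OF sobolev_diff(1)[OF m] m(2)] sobolev_add(2)[OF sobolev_diff(1)[OF m(2) m(1)] m(1)]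
      by simp
  qed
  then have "\<forall>\<^sub>F s in at t within {0..T}.
      norm (sobolev_norm r (u s) - sobolev_norm r (u t)) \<le> sobolev_norm r (u s - u t)"
    by (auto simp: eventually_at_filter)
  moreover have "((\<lambda>s. sobolev_norm r (u s - u t)) \<longlongrightarrow> 0) (at t within {0..T})"
    using assms t by (auto simp: sobolev_curve_def)
  ultimately have "((\<lambda>s. sobolev_norm r (u s) - sobolev_norm r (u t)) \<longlongrightarrow> 0) (at t within {0..T})"
    by (rule Lim_null_comparison)
  then show "((\<lambda>s. sobolev_norm r (u s)) \<longlongrightarrow> sobolev_norm r (u t)) (at t within {0..T})"
    by (simp add: LIM_zero_iff)
qed

lemma sobolev_curve_bounded:
  assumes "sobolev_curve r T u"
  obtains R where "R > 0" "\<And>t. t \<in> {0..T} \<Longrightarrow> sobolev_norm r (u t) \<le> R"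
proof -
  have "bounded ((\<lambda>t. sobolev_norm r (u t)) ` {0..T})"
    by (intro compact_imp_bounded compact_continuous_image sobolev_norm_continuous assms) auto
  then obtain R where "R > 0" "\<forall>t\<in>{0..T}. norm (sobolev_norm r (u t)) \<le> R"
    by (auto simp: bounded_pos)
  then show ?thesis
    using that by auto
qed

lemma fourier_coeff_continuous:
  assumes "sobolev_curve r T u" "0 \<le> r"
  shows "continuous_on {0..T} (\<lambda>t. fourier_coeff (u t) k)"
  unfolding continuous_on_def
proof
  fix t assume t: "t \<in> {0..T}"
  have "norm (fourier_coeff (u s) k - fourier_coeff (u t) k) \<le> sobolev_norm r (u s - u t)" if "s \<in> {0..T}" for s
  proof -
    have m: "u s \<in> sobolev r" "u t \<in> sobolev r"
      using assms t that by (auto simp: sobolev_curve_def)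
    then have "fourier_coeff (u s) k - fourier_coeff (u t) k = fourier_coeff (u s - u t) k"
      by (simp add: fourier_coeff_diff sobolev_def)
    then show ?thesis
      using fourier_coeff_le_sobolev_norm[OF sobolev_diff(1)[OF m] assms(2)] by simp
  qed
  then have "\<forall>\<^sub>F s in at t within {0..T}.
      norm (fourier_coeff (u s) k - fourier_coeff (u t) k) \<le> sobolev_norm r (u s - u t)"
    by (auto simp: eventually_at_filter)
  moreover have "((\<lambda>s. sobolev_norm r (u s - u t)) \<longlongrightarrow> 0) (at t within {0..T})"
    using assms t by (auto simp: sobolev_curve_def)
  ultimately have "((\<lambda>s. fourier_coeff (u s) k - fourier_coeff (u t) k) \<longlongrightarrow> 0) (at t within {0..T})"
    by (rule Lim_null_comparison)
  then show "((\<lambda>s. fourier_coeff (u s) k) \<longlongrightarrow> fourier_coeff (u t) k) (at t within {0..T})"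
    by (simp add: LIM_zero_iff)
qed

section \<open>Duhamel integrals as Fourier series\<close>

text \<open>Exchange of the time integral with the Fourier series. The phase time \<open>p\<close>
  is kept apart from the upper limit \<open>b\<close> because a restart needs the integral over the
  past with the group running to a later time.\<close>

lemma duhamel_fourier_series:
  fixes g :: "real \<Rightarrow> 'n::finite torus_fun" and p :: real
  assumes r: "r > real CARD('n) / 2" and g: "sobolev_curve r T g" and b: "0 \<le> b" "b \<le> T"
  defines "a \<equiv> \<lambda>k. integral {0..b} (\<lambda>s. cis (- (p - s) * freq_sq k) * fourier_coeff (g s) k)"
  shows "(\<lambda>k. norm (a k)) summable_on UNIV"
    and "((\<lambda>s. schroedinger_group (p - s) (g s) x) has_integral
           (\<Sum>\<^sub>\<infinity>k. a k * cis (freq_inner k x))) {0..b}"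
proof -
  have r0: "0 \<le> r"
    using r by (smt (verit) divide_nonneg_nonneg of_nat_0_le_iff)
  have cont: "continuous_on {0..b} (\<lambda>s. fourier_coeff (g s) k)" for k
    using fourier_coeff_continuous[OF g r0] by (rule continuous_on_subset) (use b in auto)
  have mem: "g s \<in> sobolev r" if "s \<in> {0..b}" for s
    using that g b by (auto simp: sobolev_curve_def)
  obtain R where R: "R > 0" "\<And>s. s \<in> {0..T} \<Longrightarrow> sobolev_norm r (g s) \<le> R"
    using sobolev_curve_bounded[OF g] by blast
  \<comment> \<open>The bound of \<open>fourier_coeff_summable\<close> at norm \<open>R\<close>: one
    constant for all times, which serves both for the summability of \<open>a\<close> and as the
    majorant in dominated convergence.\<close>
  define M where "M = (\<Sum>\<^sub>\<infinity>k::int^'n. (1 + freq_sq k) powr (-r)) + R\<^sup>2"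
  have M: "(\<Sum>k\<in>K. cmod (fourier_coeff (g s) k)) \<le> M" if "s \<in> {0..b}" "finite K" for s K
  proof -
    have "(\<Sum>k\<in>K. cmod (fourier_coeff (g s) k)) \<le> (\<Sum>\<^sub>\<infinity>k. cmod (fourier_coeff (g s) k))"
      using fourier_coeff_summable(1)[OF r mem] that by (intro finite_sum_le_infsum) auto
    also have "\<dots> \<le> (\<Sum>\<^sub>\<infinity>k::int^'n. (1 + freq_sq k) powr (-r)) + (sobolev_norm r (g s))\<^sup>2"
      by (rule fourier_coeff_summable(2)[OF r mem]) (use that in auto)
    also have "\<dots> \<le> M"
      unfolding M_def using R(2)[of s] that b by (intro add_left_mono power_mono) auto
    finally show ?thesis .
  qed
  have hi: "((\<lambda>s. cis (- (p - s) * freq_sq k) * fourier_coeff (g s) k) has_integral a k) {0..b}" for k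
    unfolding a_def
    by (intro integrable_integral integrable_continuous_interval continuous_intros cont)
  have ni: "(\<lambda>s. cmod (fourier_coeff (g s) k)) integrable_on {0..b}" for k
    by (intro integrable_continuous_interval continuous_intros cont)
  have "(\<Sum>k\<in>K. norm (a k)) \<le> M * b" if "finite K" for K
  proof -
    have "(\<Sum>k\<in>K. norm (a k)) \<le> (\<Sum>k\<in>K. integral {0..b} (\<lambda>s. cmod (fourier_coeff (g s) k)))"
    proof (rule sum_mono)
      fix k
      have "norm (integral {0..b} (\<lambda>s. cis (- (p - s) * freq_sq k) * fourier_coeff (g s) k))
          \<le> integral {0..b} (\<lambda>s. cmod (fourier_coeff (g s) k))"
        using hi[of k] ni by (intro integral_norm_bound_integral) (auto simp: norm_mult)
      then show "norm (a k) \<le> integral {0..b} (\<lambda>s. cmod (fourier_coeff (g s) k))"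
        by (simp add: a_def)
    qed
    also have "\<dots> = integral {0..b} (\<lambda>s. \<Sum>k\<in>K. cmod (fourier_coeff (g s) k))"
      using that ni by (simp add: integral_sum)
    also have "\<dots> \<le> integral {0..b} (\<lambda>s. M)"
      using M that ni by (intro integral_le integrable_sum) auto
    also have "\<dots> = M * b"
      using b by simp
    finally show ?thesis .
  qed
  then show sm: "(\<lambda>k. norm (a k)) summable_on UNIV"
    by (intro nonneg_bdd_above_summable_on bdd_aboveI2[where M = "M * b"]) auto
  show "((\<lambda>s. schroedinger_group (p - s) (g s) x) has_integral
           (\<Sum>\<^sub>\<infinity>k. a k * cis (freq_inner k x))) {0..b}"
  proof (rule has_integral_dominated_convergence)
    show "((\<lambda>s. \<Sum>k | to_nat k < n. cis (- (p - s) * freq_sq k) * fourier_coeff (g s) k * cis (freq_inner k x))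
        has_integral (\<Sum>k | to_nat k < n. a k * cis (freq_inner k x))) {0..b}" for n
      by (intro has_integral_sum has_integral_mult_left hi finite_to_nat_less)
    show "(\<lambda>_. M) integrable_on {0..b}"
      by (rule integrable_const_ivl)
    show "\<forall>s\<in>{0..b}. norm (\<Sum>k | to_nat k < n. cis (- (p - s) * freq_sq k) * fourier_coeff (g s) k * cis (freq_inner k x)) \<le> M" for n
    proof
      fix s assume "s \<in> {0..b}"
      then have "(\<Sum>k | to_nat k < n. cmod (fourier_coeff (g s) k)) \<le> M"
        by (rule M[OF _ finite_to_nat_less])
      moreover have "norm (\<Sum>k | to_nat k < n. cis (- (p - s) * freq_sq k) * fourier_coeff (g s) k * cis (freq_inner k x))
          \<le> (\<Sum>k | to_nat k < n. cmod (fourier_coeff (g s) k))"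
        by (rule sum_norm_le) (simp add: norm_mult)
      ultimately show "norm (\<Sum>k | to_nat k < n. cis (- (p - s) * freq_sq k) * fourier_coeff (g s) k * cis (freq_inner k x)) \<le> M"
        by linarith
    qed
    show "\<forall>s\<in>{0..b}. (\<lambda>n. \<Sum>k | to_nat k < n. cis (- (p - s) * freq_sq k) * fourier_coeff (g s) k * cis (freq_inner k x))
        \<longlonglongrightarrow> schroedinger_group (p - s) (g s) x"
      unfolding schroedinger_group_def
      by (intro ballI partial_sums_tendsto_infsum trig_terms_summable group_coeff_summable[OF r mem])
    show "(\<lambda>n. \<Sum>k | to_nat k < n. a k * cis (freq_inner k x)) \<longlonglongrightarrow> (\<Sum>\<^sub>\<infinity>k. a k * cis (freq_inner k x))"
      by (intro partial_sums_tendsto_infsum trig_terms_summable sm)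
  qed
qed

text \<open>Shaped for Duhamel's formula: the series of the free evolution minus \<open>\<i>\<close>
  times that of the integral.\<close>

lemma trig_series_combine:
  assumes a: "(\<lambda>k. norm (a k)) summable_on UNIV" and b: "(\<lambda>k. norm (b k)) summable_on UNIV"
  shows "(\<lambda>k. norm (a k - \<i> * b k)) summable_on UNIV"
    and "(\<Sum>\<^sub>\<infinity>k. (a k - \<i> * b k) * cis (\<theta> k)) = (\<Sum>\<^sub>\<infinity>k. a k * cis (\<theta> k)) - \<i> * (\<Sum>\<^sub>\<infinity>k. b k * cis (\<theta> k))"
proof -
  have "norm (a k - \<i> * b k) \<le> norm (a k) + norm (b k)" for k
    using norm_triangle_ineq4[of "a k" "\<i> * b k"] by (simp add: norm_mult)
  then show "(\<lambda>k. norm (a k - \<i> * b k)) summable_on UNIV"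
    by (intro summable_on_comparison_test[OF summable_on_add[OF a b]]) auto
  have "((\<lambda>k. a k * cis (\<theta> k) + (- \<i>) * (b k * cis (\<theta> k))) has_sum
      ((\<Sum>\<^sub>\<infinity>k. a k * cis (\<theta> k)) + (- \<i>) * (\<Sum>\<^sub>\<infinity>k. b k * cis (\<theta> k)))) UNIV"
    by (intro has_sum_add has_sum_cmult_right has_sum_infsum trig_terms_summable a b)
  then show "(\<Sum>\<^sub>\<infinity>k. (a k - \<i> * b k) * cis (\<theta> k)) = (\<Sum>\<^sub>\<infinity>k. a k * cis (\<theta> k)) - \<i> * (\<Sum>\<^sub>\<infinity>k. b k * cis (\<theta> k))"
    by (simp add: infsumI algebra_simps)
qed

lemma sobolev_curve_shift:
  assumes "sobolev_curve r T u" "0 \<le> t0" "t0 + \<tau> \<le> T"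
  shows "sobolev_curve r \<tau> (\<lambda>s. u (t0 + s))"
  unfolding sobolev_curve_def
proof (intro ballI conjI)
  fix t assume t: "t \<in> {0..\<tau>}"
  then have "t0 + t \<in> {0..T}"
    using assms by auto
  then have "u (t0 + t) \<in> sobolev r" and
    lim: "((\<lambda>s. sobolev_norm r (u s - u (t0 + t))) \<longlongrightarrow> 0) (at (t0 + t) within {0..T})"
    using assms(1) by (auto simp: sobolev_curve_def)
  then show "u (t0 + t) \<in> sobolev r" by simp
  have "filterlim (\<lambda>s. t0 + s) (at (t0 + t) within {0..T}) (at t within {0..\<tau>})"
    using assms(2,3)
    by (auto simp: filterlim_at eventually_at_filter intro!: tendsto_eq_intros always_eventually)
  from filterlim_compose[OF lim this]
  show "((\<lambda>s. sobolev_norm r (u (t0 + s) - u (t0 + t))) \<longlongrightarrow> 0) (at t within {0..\<tau>})" .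
qed


text \<open>The Duhamel integral up to time \<open>t0 + t\<close> is split at \<open>t0\<close>. The
  free evolution together with the past part equals the group at time \<open>t\<close> applied to
  \<open>u t0\<close>, by the group law on coefficients; the rest is the Duhamel integral of the
  shifted curve.\<close>

lemma exact_solution_restart:
  fixes u :: "real \<Rightarrow> 'n::finite torus_fun"
  assumes r: "r > real CARD('n) / 2" and u: "exact_solution r F T u0 u"
    and t0: "0 \<le> t0" "t0 + \<tau> \<le> T" and \<tau>: "0 \<le> \<tau>"
  shows "exact_solution r F \<tau> (u t0) (\<lambda>s. u (t0 + s))"
proof -
  let ?N = "\<lambda>s. nonlinearity F (u s)"
  have cu: "sobolev_curve r T u" and cN: "sobolev_curve r T ?N" and u0: "u 0 = u0"
    and eq: "\<And>t x. t \<in> {0..T} \<Longrightarrow> u t x = schroedinger_group t u0 x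
        - \<i> * integral {0..t} (\<lambda>s. schroedinger_group (t - s) (?N s) x)"
    using u by (auto simp: exact_solution_def)
  have u0m: "u0 \<in> sobolev r"
    using cu u0 t0 \<tau> by (auto simp: sobolev_curve_def)
  \<comment> \<open>Coefficients of the Duhamel integral over the past \<open>{0..t0}\<close> with
    the group running to time \<open>p\<close>: \<open>p = t0\<close> belongs to
    \<open>u t0\<close>, and \<open>p = t0 + t\<close> to \<open>u (t0 + t)\<close>.\<close>
  define a where "a = (\<lambda>p k. integral {0..t0} (\<lambda>s. cis (- (p - s) * freq_sq k) * fourier_coeff (?N s) k))"
  have t0T: "t0 \<le> T"
    using t0 \<tau> by simp
  have a_summable: "(\<lambda>k. norm (a p k)) summable_on UNIV" for p
    using duhamel_fourier_series(1)[OF r cN t0(1) t0T] by (simp add: a_def)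
  have a_sum: "integral {0..t0} (\<lambda>s. schroedinger_group (p - s) (?N s) x) = (\<Sum>\<^sub>\<infinity>k. a p k * cis (freq_inner k x))" for p x
    using duhamel_fourier_series(2)[OF r cN t0(1) t0T] unfolding a_def by (rule integral_unique)
  \<comment> \<open>The extra time \<open>t\<close> contributes a phase independent of
    \<open>s\<close>, which leaves the integral.\<close>
  have a_shift: "a (t0 + t) k = cis (- t * freq_sq k) * a t0 k" for t k
  proof -
    have "cis (- (t0 + t - s) * freq_sq k) = cis (- t * freq_sq k) * cis (- (t0 - s) * freq_sq k)" for s
      by (simp add: cis_mult algebra_simps)
    then show ?thesis
      by (simp add: a_def mult.assoc)
  qed
  define b where "b = (\<lambda>p k. cis (- p * freq_sq k) * fourier_coeff u0 k)"
  have b_summable: "(\<lambda>k. norm (b p k)) summable_on UNIV" for p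
    unfolding b_def by (rule group_coeff_summable[OF r u0m])
  have b_sum: "schroedinger_group p u0 x = (\<Sum>\<^sub>\<infinity>k. b p k * cis (freq_inner k x))" for p x
    by (simp add: schroedinger_group_def b_def)
  have "u t0 = (\<lambda>x. \<Sum>\<^sub>\<infinity>k. (b t0 k - \<i> * a t0 k) * cis (freq_inner k x))"
    using t0 t0T
    by (auto simp: fun_eq_iff eq a_sum b_sum trig_series_combine(2)[OF b_summable a_summable])
  \<comment> \<open>\<open>u t0\<close> is given through Duhamel's formula; once it is written as an
    absolutely convergent series, its coefficients can be read off.\<close>
  then have coeff: "fourier_coeff (u t0) k = b t0 k - \<i> * a t0 k" for k
    using trig_series_coeff[OF trig_series_combine(1)[OF b_summable a_summable]] by simp
  have restart: "u (t0 + t) x = schroedinger_group t (u t0) x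
      - \<i> * integral {0..t} (\<lambda>s. schroedinger_group (t - s) (?N (t0 + s)) x)" if t: "t \<in> {0..\<tau>}" for t x
  proof -
    let ?H = "\<lambda>s. schroedinger_group (t0 + t - s) (?N s) x"
    have tT: "0 \<le> t0 + t" "t0 + t \<le> T"
      using t t0 by auto
    have "?H integrable_on {0..t0 + t}"
      using duhamel_fourier_series(2)[OF r cN tT] by (rule has_integral_integrable)
    then have "integral {0..t0 + t} ?H = integral {0..t0} ?H + integral {t0..t0 + t} ?H"
      using t t0 by (intro Henstock_Kurzweil_Integration.integral_combine[symmetric]) auto
    moreover have "integral {t0..t0 + t} ?H = integral {0..t} (\<lambda>s. schroedinger_group (t - s) (?N (t0 + s)) x)"
      using integral_shift_Icc_real[of 0 t ?H t0] by (simp add: o_def add.commute)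
    moreover have "schroedinger_group t (u t0) x =
        (\<Sum>\<^sub>\<infinity>k. (b (t0 + t) k - \<i> * a (t0 + t) k) * cis (freq_inner k x))"
      unfolding schroedinger_group_def coeff a_shift
      by (intro infsum_cong) (simp add: b_def cis_mult algebra_simps)
    then have "schroedinger_group t (u t0) x = schroedinger_group (t0 + t) u0 x - \<i> * integral {0..t0} ?H"
      by (simp add: a_sum b_sum trig_series_combine(2)[OF b_summable a_summable])
    moreover have "u (t0 + t) x = schroedinger_group (t0 + t) u0 x - \<i> * integral {0..t0 + t} ?H"
      using tT by (intro eq) auto
    ultimately show ?thesis
      by (simp only: distrib_left diff_diff_eq)
  qed
  show ?thesis
    unfolding exact_solution_def
    using sobolev_curve_shift[OF cu t0] sobolev_curve_shift[OF cN t0] restart by simp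
qed

section \<open>Error propagation of the parareal iteration\<close>

text \<open>The step inequality is assumed only while \<open>a n \<le> 1\<close>; the bound being
  proved restores this condition through \<open>small\<close>, so the bootstrap closes. The
  induction carries the elapsed time \<open>n * \<tau>\<close> in place of \<open>T\<close>, as the
  bound in \<open>T\<close> does not reproduce itself.\<close>

lemma discrete_gronwall:
  fixes a :: "nat \<Rightarrow> real"
  assumes "a 0 = 0" and \<tau>: "0 \<le> \<tau>" and C: "0 \<le> C" and d: "0 \<le> d"
    and T: "real N * \<tau> \<le> T" and small: "T * exp (C * T) * d \<le> 1"
    and step: "\<And>n. n < N \<Longrightarrow> a n \<le> 1 \<Longrightarrow> a (Suc n) \<le> (1 + C * \<tau>) * a n + \<tau> * d"
    and n: "n \<le> N"
  shows "a n \<le> T * exp (C * T) * d"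
proof -
  have le: "real n * \<tau> * exp (C * (real n * \<tau>)) * d \<le> T * exp (C * T) * d" if "n \<le> N" for n
  proof -
    have "real n * \<tau> \<le> real N * \<tau>"
      using that \<tau> by (intro mult_right_mono) auto
    then have "real n * \<tau> \<le> T"
      using T by linarith
    moreover have "0 \<le> real n * \<tau>"
      using \<tau> by simp
    ultimately show ?thesis
      using C d by (intro mult_right_mono mult_mono) (auto intro: mult_left_mono)
  qed
  have "a n \<le> real n * \<tau> * exp (C * (real n * \<tau>)) * d"
    using n
  proof (induction n)
    case 0
    then show ?case using assms(1) by simp
  next
    case (Suc n)
    define E where "E = exp (C * (real n * \<tau>))"
    define E' where "E' = exp (C * (real (Suc n) * \<tau>))"
    have E': "E' = E * exp (C * \<tau>)"
      by (simp add: E_def E'_def exp_add[symmetric] algebra_simps)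
    have "1 + C * \<tau> \<le> exp (C * \<tau>)"
      by (rule exp_ge_add_one_self)
    then have EE: "(1 + C * \<tau>) * E \<le> E'"
      unfolding E' by (simp add: E_def mult.commute)
    have E1: "1 \<le> E'"
      using C \<tau> by (simp add: E'_def)
    have IH: "a n \<le> real n * \<tau> * E * d"
      using Suc by (simp add: E_def)
    \<comment> \<open>Bootstrap: the induction hypothesis itself permits the next step.\<close>
    have "a n \<le> 1"
      using IH le[of n] small Suc.prems by (simp add: E_def)
    then have "a (Suc n) \<le> (1 + C * \<tau>) * a n + \<tau> * d"
      using step Suc.prems by simp
    also have "\<dots> \<le> (1 + C * \<tau>) * (real n * \<tau> * E * d) + \<tau> * d"
      using IH C \<tau> by (intro add_right_mono mult_left_mono) auto
    also have "\<dots> = real n * \<tau> * d * ((1 + C * \<tau>) * E) + \<tau> * d * 1"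
      by (simp add: algebra_simps)
    \<comment> \<open>The growth factor is absorbed into the exponential, and the source is enlarged
      by \<open>E' \<ge> 1\<close>, so that both summands share the factor
      \<open>E'\<close>.\<close>
    also have "\<dots> \<le> real n * \<tau> * d * E' + \<tau> * d * E'"
      using EE E1 \<tau> d by (intro add_mono mult_left_mono) auto
    also have "\<dots> = real (Suc n) * \<tau> * E' * d"
      by (simp add: algebra_simps)
    finally show ?case
      by (simp add: E'_def)
  qed
  with le[OF n] show ?thesis by linarith
qed

text \<open>Induction on \<open>k\<close>: the previous iterate acts as the source in Gronwall's
  estimate, and each iteration gains the factor \<open>C * K * \<tau>\<close>. At
  \<open>k = 0\<close> the claim is the bound 1, so the coarse defect enters only through
  \<open>K * \<delta> \<le> 1\<close>.\<close>

lemma parareal_error_recursion: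
  fixes e :: "nat \<Rightarrow> nat \<Rightarrow> real"
  assumes zero: "\<And>k. e k 0 = 0" and \<tau>: "0 \<le> \<tau>" and C: "0 \<le> C" and \<delta>: "0 \<le> \<delta>"
    and T: "real N * \<tau> \<le> T"
  defines "K \<equiv> T * exp (C * T)"
  assumes small: "K * \<delta> \<le> 1" "C * K * \<tau> \<le> 1"
    and step0: "\<And>n. n < N \<Longrightarrow> e 0 n \<le> 1 \<Longrightarrow> e 0 (Suc n) \<le> (1 + C * \<tau>) * e 0 n + \<tau> * \<delta>"
    and step: "\<And>k n. n < N \<Longrightarrow> e k n \<le> 1 \<Longrightarrow> e (Suc k) n \<le> 1 \<Longrightarrow>
      e (Suc k) (Suc n) \<le> (1 + C * \<tau>) * e (Suc k) n + C * \<tau>\<^sup>2 * e k n"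
    and n: "n \<le> N"
  shows "e k n \<le> (C * K * \<tau>) ^ k"
  using n
proof (induction k arbitrary: n)
  case 0
  have "e 0 n \<le> T * exp (C * T) * \<delta>"
    by (rule discrete_gronwall[where a = "e 0" and N = N and C = C and \<tau> = \<tau>])
       (use zero \<tau> C \<delta> T small step0 0 in \<open>auto simp: K_def\<close>)
  then show ?case
    using small by (simp add: K_def)
next
  case (Suc k)
  have "0 \<le> real N * \<tau>"
    using \<tau> by simp
  then have "0 \<le> T"
    using T by linarith
  then have K: "0 \<le> K"
    by (simp add: K_def)
  define d where "d = C * \<tau> * (C * K * \<tau>) ^ k"
  have q: "0 \<le> C * K * \<tau>"
    using C K \<tau> by simp
  have d: "0 \<le> d"
    using C \<tau> q by (simp add: d_def)
  have Kd: "K * d = (C * K * \<tau>) ^ Suc k"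
    by (simp add: d_def)
  \<comment> \<open>Used twice: at \<open>k\<close> it keeps the previous iterate within distance 1,
    and at \<open>Suc k\<close> it is the smallness condition of Gronwall's estimate.\<close>
  have le1: "(C * K * \<tau>) ^ j \<le> 1" for j
    using q small(2) by (rule power_le_one)
  have "e (Suc k) n \<le> T * exp (C * T) * d"
  proof (rule discrete_gronwall[where a = "e (Suc k)" and N = N and C = C and \<tau> = \<tau>])
    show "T * exp (C * T) * d \<le> 1"
      using le1[of "Suc k"] by (simp only: Kd flip: K_def)
    fix m assume m: "m < N" "e (Suc k) m \<le> 1"
    have IH: "e k m \<le> (C * K * \<tau>) ^ k"
      using Suc.IH[of m] m by simp
    then have "e (Suc k) (Suc m) \<le> (1 + C * \<tau>) * e (Suc k) m + C * \<tau>\<^sup>2 * e k m"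
      using m le1[of k] by (intro step) auto
    also have "\<dots> \<le> (1 + C * \<tau>) * e (Suc k) m + C * \<tau>\<^sup>2 * (C * K * \<tau>) ^ k"
      using IH C by (intro add_left_mono mult_left_mono) auto
    also have "C * \<tau>\<^sup>2 * (C * K * \<tau>) ^ k = \<tau> * d"
      by (simp add: d_def power2_eq_square)
    finally show "e (Suc k) (Suc m) \<le> (1 + C * \<tau>) * e (Suc k) m + \<tau> * d" .
  qed (use zero \<tau> C d T Suc.prems in auto)
  then show ?case
    unfolding Kd[symmetric] by (simp only: K_def)
qed

section \<open>Parareal convergence for the Schroedinger equation\<close>

theorem theorem4p1:
  fixes r T :: real
    and F :: "complex \<Rightarrow> complex \<Rightarrow> complex"
    and \<Phi> :: "real \<Rightarrow> 'n::finite torus_fun \<Rightarrow> 'n torus_fun"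
    and u0 :: "'n torus_fun"
    and u :: "real \<Rightarrow> 'n torus_fun"
  defines "\<F> \<equiv> fine_propagator r F"
    and "\<G> \<equiv> coarse_propagator \<Phi>"
  assumes r: "r > real CARD('n) / 2"
    and T: "T > 0"
    and fine_well_defined:
      "\<And>\<tau> (v :: 'n torus_fun). 0 < \<tau> \<Longrightarrow> \<tau> \<le> 1 \<Longrightarrow> v \<in> sobolev r \<Longrightarrow> \<exists>!z. fine_value r F \<tau> v z"
    and coarse_well_defined:
      "\<And>\<tau> v. 0 < \<tau> \<Longrightarrow> \<tau> \<le> 1 \<Longrightarrow> v \<in> sobolev r \<Longrightarrow> \<Phi> \<tau> v \<in> sobolev r"
    and lipschitz:
      "\<And>R. R > 0 \<Longrightarrow> \<exists>C. \<forall>w0\<in>sobolev_ball r R. \<forall>v0\<in>sobolev_ball r R. \<forall>\<tau>. 0 < \<tau> \<and> \<tau> \<le> 1 \<longrightarrow>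
         sobolev_norm r (\<Phi> \<tau> w0 - \<Phi> \<tau> v0) \<le> C * \<tau> * sobolev_norm r (w0 - v0) \<and>
         sobolev_norm r ((\<F> \<tau> - \<G> \<tau>) w0 - (\<F> \<tau> - \<G> \<tau>) v0) \<le> C * \<tau>\<^sup>2 * sobolev_norm r (w0 - v0)"
    and consistent_at_zero:
      "((\<lambda>\<tau>. sobolev_norm r ((\<F> \<tau> - \<G> \<tau>) 0) / \<tau>) \<longlongrightarrow> 0) (at_right 0)"
    and exact: "exact_solution r F T u0 u"
  shows "\<exists>\<tau>0 C1 C2. \<tau>0 > 0 \<and> C1 > 0 \<and> C2 > 0 \<and>
    (\<forall>\<tau> Nc k. 0 < \<tau> \<and> \<tau> \<le> \<tau>0 \<and> T / \<tau> = real Nc \<longrightarrow>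
      (MAX n\<in>{1..Nc}. sobolev_norm r (parareal (\<G> \<tau>) (\<F> \<tau>) u0 k n - u (real n * \<tau>)))
        \<le> C1 * (C2 * \<tau>) ^ k)"
proof -
  have cu: "sobolev_curve r T u" and u0: "u 0 = u0"
    using exact by (auto simp: exact_solution_def)
  have um: "u t \<in> sobolev r" if "t \<in> {0..T}" for t
    using cu that by (auto simp: sobolev_curve_def)
  obtain R where R: "R > 0" "\<And>t. t \<in> {0..T} \<Longrightarrow> sobolev_norm r (u t) \<le> R"
    using sobolev_curve_bounded[OF cu] by blast
  \<comment> \<open>The radius leaves a margin of 1 around the exact solution, so an iterate with
    error at most 1 lies in the ball; this is the threshold 1 of the error recursion.\<close>
  obtain C' where C': "\<forall>w0\<in>sobolev_ball r (R + 1). \<forall>v0\<in>sobolev_ball r (R + 1). \<forall>\<tau>. 0 < \<tau> \<and> \<tau> \<le> 1 \<longrightarrow>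
         sobolev_norm r (\<Phi> \<tau> w0 - \<Phi> \<tau> v0) \<le> C' * \<tau> * sobolev_norm r (w0 - v0) \<and>
         sobolev_norm r ((\<F> \<tau> - \<G> \<tau>) w0 - (\<F> \<tau> - \<G> \<tau>) v0) \<le> C' * \<tau>\<^sup>2 * sobolev_norm r (w0 - v0)"
    using lipschitz[of "R + 1"] R by auto
  \<comment> \<open>\<open>C'\<close> may be any real number; the maximum makes the constant
    positive, as needed for dividing by it and for \<open>C2 > 0\<close>.\<close>
  define C where "C = max C' 1"
  have C: "C \<ge> 1" "C' \<le> C"
    by (auto simp: C_def)
  have lip: "sobolev_norm r (\<Phi> \<tau> w - \<Phi> \<tau> v) \<le> C * \<tau> * sobolev_norm r (w - v)"
    "sobolev_norm r ((\<F> \<tau> - \<G> \<tau>) w - (\<F> \<tau> - \<G> \<tau>) v) \<le> C * \<tau>\<^sup>2 * sobolev_norm r (w - v)"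
    if "0 < \<tau>" "\<tau> \<le> 1" "w \<in> sobolev_ball r (R + 1)" "v \<in> sobolev_ball r (R + 1)" for \<tau> v w
  proof -
    note lip' = C'[rule_format, OF that(3,4) conjI[OF that(1,2)]]
    have "C' * \<tau> * sobolev_norm r (w - v) \<le> C * \<tau> * sobolev_norm r (w - v)"
      using that(1) C(2) by (intro mult_right_mono) auto
    with lip' show "sobolev_norm r (\<Phi> \<tau> w - \<Phi> \<tau> v) \<le> C * \<tau> * sobolev_norm r (w - v)"
      by linarith
    have "C' * \<tau>\<^sup>2 * sobolev_norm r (w - v) \<le> C * \<tau>\<^sup>2 * sobolev_norm r (w - v)"
      using C(2) by (intro mult_right_mono) auto
    with lip' show "sobolev_norm r ((\<F> \<tau> - \<G> \<tau>) w - (\<F> \<tau> - \<G> \<tau>) v) \<le> C * \<tau>\<^sup>2 * sobolev_norm r (w - v)"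
      by linarith
  qed
  define K where "K = T * exp (C * T)"
  have K: "K > 0"
    using T by (simp add: K_def)
  have "\<forall>\<^sub>F \<tau> in at_right 0. sobolev_norm r ((\<F> \<tau> - \<G> \<tau>) 0) / \<tau> < 1 / (2 * K)"
    using K by (intro order_tendstoD(2)[OF consistent_at_zero]) simp
  then obtain \<tau>1 where \<tau>1: "\<tau>1 > 0" "\<And>\<tau>. 0 < \<tau> \<Longrightarrow> \<tau> < \<tau>1 \<Longrightarrow> sobolev_norm r ((\<F> \<tau> - \<G> \<tau>) 0) / \<tau> < 1 / (2 * K)"
    by (auto simp: eventually_at_right_field)
  \<comment> \<open>In order: the range of (i) and (ii); strictly inside the range where the defect
    at 0 is below \<open>\<tau> / (2 * K)\<close>; \<open>C * K * \<tau> \<le> 1\<close> for the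
    recursion; and \<open>C * R * \<tau> \<le> 1 / (2 * K)\<close>, the other half of the admissible
    defect \<open>\<tau> / K\<close>.\<close>
  define \<tau>0 where "\<tau>0 = Min {1, \<tau>1 / 2, 1 / (C * K), 1 / (2 * K * C * R)}"
  have "\<tau>0 > 0"
    using \<tau>1 C K R by (simp add: \<tau>0_def)
  have bound: "(MAX n\<in>{1..Nc}. sobolev_norm r (parareal (\<G> \<tau>) (\<F> \<tau>) u0 k n - u (real n * \<tau>)))
        \<le> (C * K * \<tau>) ^ k"
    if \<tau>: "0 < \<tau>" "\<tau> \<le> \<tau>0" and Nc: "T / \<tau> = real Nc" for \<tau> Nc k
  proof -
    have small: "\<tau> \<le> 1" "\<tau> < \<tau>1" "\<tau> \<le> 1 / (C * K)" "\<tau> \<le> 1 / (2 * K * C * R)"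
      using \<tau> \<tau>1(1) by (auto simp: \<tau>0_def)
    have NcT: "real Nc * \<tau> = T"
      using Nc \<tau> by (simp add: field_simps)
    \<comment> \<open>Makes the index set of the maximum nonempty.\<close>
    have Nc1: "Nc \<ge> 1"
      using NcT T by (cases Nc) auto
    have grid: "real n * \<tau> \<in> {0..T}" if "n \<le> Nc" for n
      using that \<tau>(1) NcT mult_right_mono[of "real n" "real Nc" \<tau>] by auto
    \<comment> \<open>Unique existence turns the definite description into an actual value of an
      exact solution.\<close>
    have fine: "fine_value r F \<tau> v (\<F> \<tau> v)" if "v \<in> sobolev r" for v
      unfolding \<F>_def fine_propagator_def by (rule theI'[OF fine_well_defined[OF \<tau>(1) small(1) that]])
    have Fm: "\<F> \<tau> v \<in> sobolev r" if "v \<in> sobolev r" for v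
      using fine[OF that] \<tau>(1) by (auto simp: fine_value_def exact_solution_def sobolev_curve_def)
    have Gm: "\<G> \<tau> v \<in> sobolev r" if "v \<in> sobolev r" for v
      unfolding \<G>_def coarse_propagator_def
      by (intro sobolev_add schroedinger_group_sobolev r that coarse_well_defined \<tau>(1) small(1))
    have FGm: "(\<F> \<tau> - \<G> \<tau>) v \<in> sobolev r" if "v \<in> sobolev r" for v
      using sobolev_diff(1)[OF Fm Gm] that by simp
    let ?U = "parareal (\<G> \<tau>) (\<F> \<tau>) u0"
    define w where "w = (\<lambda>n. u (real n * \<tau>))"
    \<comment> \<open>\<open>k\<close> is generalised because grid point \<open>n + 1\<close> of an
      iterate uses grid point \<open>n\<close> of both that iterate and the previous one.\<close>
    have Um: "?U k n \<in> sobolev r" for k n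
    proof (induction n arbitrary: k)
      case 0
      then show ?case using um[of 0] u0 T by simp
    next
      case (Suc n)
      show ?case
      proof (cases k)
        case 0
        then show ?thesis using Gm[OF Suc.IH] by simp
      next
        case (Suc k')
        then show ?thesis
          using sobolev_add(1)[OF Gm[OF Suc.IH[of k]] FGm[OF Suc.IH[of k']]]
          by (simp add: plus_fun_def del: minus_apply)
      qed
    qed
    have wm: "w n \<in> sobolev r" "sobolev_norm r (w n) \<le> R" if "n \<le> Nc" for n
      using um R(2) grid[OF that] by (auto simp: w_def)
    have w_ball: "w n \<in> sobolev_ball r (R + 1)" if "n \<le> Nc" for n
      using wm[OF that] by (simp add: sobolev_ball_def)
    \<comment> \<open>The restarted solution starts at \<open>w n\<close> and reaches
      \<open>w (Suc n)\<close> after time \<open>\<tau>\<close>, so uniqueness of the fine value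
      identifies the two.\<close>
    have w_Suc: "w (Suc n) = \<F> \<tau> (w n)" if "n < Nc" for n
    proof -
      have "real n * \<tau> + \<tau> \<le> T"
        using grid[of "Suc n"] that by (auto simp: algebra_simps)
      then have "exact_solution r F \<tau> (u (real n * \<tau>)) (\<lambda>s. u (real n * \<tau> + s))"
        using grid[of n] that \<tau>(1) by (intro exact_solution_restart[OF r exact]) auto
      then have "fine_value r F \<tau> (w n) (w (Suc n))"
        by (auto simp: fine_value_def w_def algebra_simps)
      moreover have "w n \<in> sobolev r"
        using that by (intro wm) simp
      ultimately show ?thesis
        using fine_well_defined[OF \<tau>(1) small(1)] fine by blast
    qed
    define e where "e = (\<lambda>k n. sobolev_norm r (?U k n - w n))"
    have U_ball: "?U k n \<in> sobolev_ball r (R + 1)" if "n \<le> Nc" "e k n \<le> 1" for k n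
      using sobolev_add(2)[OF sobolev_diff(1)[OF Um wm(1)[OF that(1)]] wm(1)[OF that(1)], of k n] wm(2)[OF that(1)] that(2) Um
      by (simp add: sobolev_ball_def e_def)
    \<comment> \<open>The linear part is an isometry and contributes the 1; hypothesis (i)
      contributes \<open>C * \<tau>\<close>.\<close>
    have coarse_step: "\<G> \<tau> v - \<G> \<tau> (w n) \<in> sobolev r"
      "sobolev_norm r (\<G> \<tau> v - \<G> \<tau> (w n)) \<le> (1 + C * \<tau>) * sobolev_norm r (v - w n)"
      if n: "n \<le> Nc" and v: "v \<in> sobolev_ball r (R + 1)" for n v
    proof -
      have vm: "v \<in> sobolev r"
        using v by (simp add: sobolev_ball_def)
      show "\<G> \<tau> v - \<G> \<tau> (w n) \<in> sobolev r"
        by (intro sobolev_diff Gm vm wm n)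
      have "\<G> \<tau> v - \<G> \<tau> (w n) = schroedinger_group \<tau> (v - w n) + (\<Phi> \<tau> v - \<Phi> \<tau> (w n))"
        by (simp add: \<G>_def coarse_propagator_def schroedinger_group_diff[OF r vm wm(1)[OF n]])
      then have "sobolev_norm r (\<G> \<tau> v - \<G> \<tau> (w n)) \<le>
          sobolev_norm r (schroedinger_group \<tau> (v - w n)) + sobolev_norm r (\<Phi> \<tau> v - \<Phi> \<tau> (w n))"
        using sobolev_add(2)[OF schroedinger_group_sobolev[OF r sobolev_diff(1)[OF vm wm(1)[OF n]]]
            sobolev_diff(1)[OF coarse_well_defined[OF \<tau>(1) small(1) vm] coarse_well_defined[OF \<tau>(1) small(1) wm(1)[OF n]]]]
        by simp
      also have "\<dots> \<le> sobolev_norm r (v - w n) + C * \<tau> * sobolev_norm r (v - w n)"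
        using lip(1)[OF \<tau>(1) small(1) v w_ball[OF n]]
        by (simp add: sobolev_norm_schroedinger_group[OF r sobolev_diff(1)[OF vm wm(1)[OF n]]])
      finally show "sobolev_norm r (\<G> \<tau> v - \<G> \<tau> (w n)) \<le> (1 + C * \<tau>) * sobolev_norm r (v - w n)"
        by (simp add: algebra_simps)
    qed
    \<comment> \<open>The defect at \<open>w n\<close> is compared with the defect at the zero
      function: (ii) bounds the difference by \<open>C * \<tau>\<^sup>2 * R\<close>, and consistency
      bounds the value at zero. Each part is at most \<open>\<tau> / (2 * K)\<close>.\<close>
    have defect: "sobolev_norm r ((\<F> \<tau> - \<G> \<tau>) (w n)) \<le> \<tau> * (1 / K)" if n: "n \<le> Nc" for n
    proof -
      have zm: "0 \<in> sobolev_ball r (R + 1)"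
        using R by (simp add: sobolev_ball_def zero_in_sobolev)
      have "sobolev_norm r ((\<F> \<tau> - \<G> \<tau>) (w n)) \<le>
          sobolev_norm r ((\<F> \<tau> - \<G> \<tau>) (w n) - (\<F> \<tau> - \<G> \<tau>) 0) + sobolev_norm r ((\<F> \<tau> - \<G> \<tau>) 0)"
        using sobolev_add(2)[OF sobolev_diff(1)[OF FGm[OF wm(1)[OF n]] FGm[OF zero_in_sobolev]] FGm[OF zero_in_sobolev]]
        by (simp del: minus_apply)
      also have "\<dots> \<le> C * \<tau>\<^sup>2 * sobolev_norm r (w n) + \<tau> * (1 / (2 * K))"
        using lip(2)[OF \<tau>(1) small(1) w_ball[OF n] zm] \<tau>1(2)[OF \<tau>(1) small(2)] \<tau>(1)
        by (intro add_mono) (auto simp: pos_divide_less_eq mult.commute simp del: minus_apply)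
      also have "\<dots> \<le> C * \<tau>\<^sup>2 * R + \<tau> * (1 / (2 * K))"
        using wm(2)[OF n] C by (intro add_right_mono mult_left_mono) auto
      also have "C * \<tau>\<^sup>2 * R = \<tau> * (C * R * \<tau>)"
        by (simp add: power2_eq_square)
      also have "C * R * \<tau> \<le> 1 / (2 * K)"
        using small(4) C K R by (simp add: field_simps)
      then have "\<tau> * (C * R * \<tau>) + \<tau> * (1 / (2 * K)) \<le> \<tau> * (1 / (2 * K)) + \<tau> * (1 / (2 * K))"
        using \<tau>(1) by (intro add_right_mono mult_left_mono) auto
      also have "\<dots> = \<tau> * (1 / K)"
        by simp
      finally show ?thesis .
    qed
    have "e k n \<le> (C * K * \<tau>) ^ k" if n: "n \<le> Nc" for n
      unfolding K_def
    proof (rule parareal_error_recursion[where \<delta> = "1 / K" and N = Nc])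
      show "e k 0 = 0" for k
        by (simp add: e_def w_def u0)
      show "T * exp (C * T) * (1 / K) \<le> 1" "C * (T * exp (C * T)) * \<tau> \<le> 1"
        using small(3) C K by (auto simp: K_def[symmetric] field_simps)
      show "e 0 (Suc n) \<le> (1 + C * \<tau>) * e 0 n + \<tau> * (1 / K)" if n: "n < Nc" and le: "e 0 n \<le> 1" for n
      proof -
        have n': "n \<le> Nc" using n by simp
        note cs = coarse_step[OF n' U_ball[OF n' le]]
        \<comment> \<open>The fine value of \<open>w n\<close> is its coarse value plus its
          defect.\<close>
        have "?U 0 (Suc n) - w (Suc n) = (\<G> \<tau> (?U 0 n) - \<G> \<tau> (w n)) - (\<F> \<tau> - \<G> \<tau>) (w n)"
          by (simp add: w_Suc[OF n])
        then have "e 0 (Suc n) \<le> sobolev_norm r (\<G> \<tau> (?U 0 n) - \<G> \<tau> (w n)) + sobolev_norm r ((\<F> \<tau> - \<G> \<tau>) (w n))"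
          using sobolev_diff(2)[OF cs(1) FGm[OF wm(1)[OF n']]] by (simp only: e_def)
        then show ?thesis
          using cs(2) defect[OF n'] by (simp add: e_def del: minus_apply)
      qed
      show "e (Suc k) (Suc n) \<le> (1 + C * \<tau>) * e (Suc k) n + C * \<tau>\<^sup>2 * e k n"
        if n: "n < Nc" and le: "e k n \<le> 1" "e (Suc k) n \<le> 1" for k n
      proof -
        have n': "n \<le> Nc" using n by simp
        note cs = coarse_step[OF n' U_ball[OF n' le(2)]]
        \<comment> \<open>With \<open>w (Suc n)\<close> split in the same way, the previous iterate
          appears only under the difference of the propagators, where (ii) gives the factor
          \<open>C * \<tau>\<^sup>2\<close>.\<close>
        have "?U (Suc k) (Suc n) - w (Suc n) = (\<G> \<tau> (?U (Suc k) n) - \<G> \<tau> (w n)) +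
            ((\<F> \<tau> - \<G> \<tau>) (?U k n) - (\<F> \<tau> - \<G> \<tau>) (w n))"
          by (simp add: w_Suc[OF n])
        then have "e (Suc k) (Suc n) \<le> sobolev_norm r (\<G> \<tau> (?U (Suc k) n) - \<G> \<tau> (w n)) +
            sobolev_norm r ((\<F> \<tau> - \<G> \<tau>) (?U k n) - (\<F> \<tau> - \<G> \<tau>) (w n))"
          using sobolev_add(2)[OF cs(1) sobolev_diff(1)[OF FGm[OF Um[of k n]] FGm[OF wm(1)[OF n']]]]
          by (simp only: e_def)
        then show ?thesis
          using cs(2) lip(2)[OF \<tau>(1) small(1) U_ball[OF n' le(1)] w_ball[OF n']]
          by (simp add: e_def del: minus_apply parareal.simps)
      qed
    qed (use \<tau> C K NcT n in auto)
    then show ?thesis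
      using Nc1 by (simp add: e_def w_def)
  qed
  show ?thesis
    \<comment> \<open>\<open>C1 = 1\<close> suffices because the errors at \<open>k = 0\<close> are
      already at most 1.\<close>
    using \<open>\<tau>0 > 0\<close> C K bound by (intro exI[of _ \<tau>0] exI[of _ 1] exI[of _ "C * K"]) auto
qed

end
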